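(* There exist absolute constants $C_3>0$ and $C_4>0$ such that the following holds. Let $\eta\in(0,1/2)$, let $p\ge 2^{1/\eta}$ be an odd prime, let $\gamma\in\big(0,\eta-\frac{\log2}{\log p}\big]$, let $N\ge1$ be an integer, and let $\alpha\in\mathscr B(p,N)$ satisfy $\mathfrak d_{p,N}(O,\alpha)\ge p^{\gamma-\eta}$, where $O=0$. Then \[ \frac1{\#\mathcal V(p,N)}\#\big\{\beta\in\mathcal V(p,N):\ |\cos(\widehat{\alpha O\beta})|\le C_3p^{-\gamma}\big\}\ \ge\ 1-\frac{C_4}{p^{1-2\eta}}. \]
   Context: $\omega=\exp(2\pi i/p)$; $\mathscr B(p,N)=\{\sum_{j=1}^{p-1}a_j\omega^j: a_j\in[-N,N]\cap\mathbb{Z}\}$, $\mathcal V(p,N)=\{\sum_{j=1}^{p-1}a_j\omega^j: a_j\in\{-N,N\}\}$. For $\gamma'\in\mathbb{Q}(\omega)$, $\mathrm{Tr}(\gamma')=\sum_{\sigma\in\mathrm{Gal}(\mathbb{Q}(\omega)/\mathbb{Q})}\sigma(\gamma')$, $\|\gamma'\|=\big(\sum_{j=1}^{p-1}\mathrm{Tr}(\gamma'\omega^j)^2\big)^{1/2}$, $\mathfrak d_{p,N}(\alpha,\beta)=\|\beta-\alpha\|/(2Np(p-1)^{1/2})$. The angle is defined by the law of cosines in this metric: $\cos(\widehat{\alpha O\beta})=\dfrac{\mathfrak d_{p,N}(O,\alpha)^2+\mathfrak d_{p,N}(O,\beta)^2-\mathfrak d_{p,N}(\alpha,\beta)^2}{2\,\mathfrak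 d_{p,N}(O,\alpha)\,\mathfrak d_{p,N}(O,\beta)}$. *)

theory Defs
  imports Complex_Main
    "HOL-Algebra.Generated_Fields"
    "HOL-Algebra.QuotRing"
    "HOL-Algebra.Algebraic_Closure_Type"
begin

definition zeta :: "nat \<Rightarrow> complex" where
  "zeta p = exp (2 * of_real pi * \<i> / of_nat p)"

definition cyclotomic_field :: "nat \<Rightarrow> complex ring" where
  "cyclotomic_field p =
     ring_of_type_algebra
       \<lparr>carrier := generate_field ring_of_type_algebra (\<rat> \<union> {zeta p})\<rparr>"

text \<open>Membership in \<^const>\<open>ring_iso\<close> only constrains a function on the carrier. Intersecting
  with \<^const>\<open>extensional\<close> makes each automorphism a single function; otherwise the set would
  be infinite and the sum defining the trace would be zero by convention.\<close>

definition cyclotomic_gal :: "nat \<Rightarrow> (complex \<Rightarrow> complex) set" where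
  "cyclotomic_gal p =
     {\<sigma> \<in> ring_iso (cyclotomic_field p) (cyclotomic_field p).
        \<sigma> \<in> extensional (carrier (cyclotomic_field p)) \<and> (\<forall>q\<in>\<rat>. \<sigma> q = q)}"

definition cyclotomic_trace :: "nat \<Rightarrow> complex \<Rightarrow> complex" where
  "cyclotomic_trace p z = (\<Sum>\<sigma>\<in>cyclotomic_gal p. \<sigma> z)"

text \<open>Traces of elements of the cyclotomic field are rational, so taking \<^const>\<open>Re\<close> only
  changes the type from \<^typ>\<open>complex\<close> to \<^typ>\<open>real\<close>.\<close>

definition trace_norm :: "nat \<Rightarrow> complex \<Rightarrow> real" where
  "trace_norm p z = sqrt (\<Sum>j=1..p-1. (Re (cyclotomic_trace p (z * zeta p ^ j)))\<^sup>2)"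

definition cyc_dist :: "nat \<Rightarrow> int \<Rightarrow> complex \<Rightarrow> complex \<Rightarrow> real" where
  "cyc_dist p N \<alpha> \<beta> =
     trace_norm p (\<beta> - \<alpha>) / (2 * real_of_int N * real p * sqrt (real p - 1))"

definition cyc_box :: "nat \<Rightarrow> int \<Rightarrow> complex set" where
  "cyc_box p N =
     {(\<Sum>j=1..p-1. of_int (a j) * zeta p ^ j) | a :: nat \<Rightarrow> int. \<forall>j\<in>{1..p-1}. a j \<in> {-N..N}}"

definition cyc_vertices :: "nat \<Rightarrow> int \<Rightarrow> complex set" where
  "cyc_vertices p N =
     {(\<Sum>j=1..p-1. of_int (a j) * zeta p ^ j) | a :: nat \<Rightarrow> int. \<forall>j\<in>{1..p-1}. a j \<in> {-N, N}}"

text \<open>The cosine of the angle at \<open>v\<close> in the triangle \<open>\<alpha> v \<beta>\<close>, given by the law of cosines.\<close>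

definition cyc_cos_angle :: "nat \<Rightarrow> int \<Rightarrow> complex \<Rightarrow> complex \<Rightarrow> complex \<Rightarrow> real" where
  "cyc_cos_angle p N \<alpha> v \<beta> =
     ((cyc_dist p N v \<alpha>)\<^sup>2 + (cyc_dist p N v \<beta>)\<^sup>2 - (cyc_dist p N \<alpha> \<beta>)\<^sup>2)
       / (2 * cyc_dist p N v \<alpha> * cyc_dist p N v \<beta>)"

end

theory Submission
  imports Defs
begin

text \<open>
  Write \<open>\<alpha> = \<Sum>a\<^sub>j\<omega>\<^sup>j\<close>, \<open>\<beta> = \<Sum>b\<^sub>j\<omega>\<^sup>j\<close>. The trace of \<open>\<omega>\<^sup>j\<close> is \<open>p - 1\<close> or \<open>-1\<close> according to
  whether \<open>p\<close> divides \<open>j\<close>, so the norm comes from the bilinear form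
  \<open>\<langle>\<alpha>, \<beta>\<rangle> = p\<^sup>2 (\<Sum>a\<^sub>jb\<^sub>j) - (p + 1) (\<Sum>a\<^sub>j) (\<Sum>b\<^sub>j)\<close> and the cosine is \<open>\<langle>\<alpha>, \<beta>\<rangle> / (\<parallel>\<alpha>\<parallel> \<parallel>\<beta>\<parallel>)\<close>.
  For a uniformly random vertex \<open>\<beta>\<close> the \<open>b\<^sub>j\<close> are independent signs times \<open>N\<close>; the second
  moment of \<open>\<Sum>b\<^sub>j\<close> is \<open>N\<^sup>2 (p - 1)\<close>, and that of \<open>\<langle>\<alpha>, \<beta>\<rangle>\<close> is at most \<open>N\<^sup>2 p\<^sup>2 \<parallel>\<alpha>\<parallel>\<^sup>2\<close>. By Chebyshev's
  inequality, \<open>\<parallel>\<beta>\<parallel>\<^sup>2 \<ge> p\<^sup>2 N\<^sup>2 (p - 1) / 2\<close> outside a set of proportion \<open>O(1/p)\<close>, and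
  \<open>\<bar>\<langle>\<alpha>, \<beta>\<rangle>\<bar> \<le> p powr (-\<gamma>) \<parallel>\<alpha>\<parallel> \<parallel>\<beta>\<parallel>\<close> outside a further set of proportion \<open>O(p powr (2 \<gamma> - 1))\<close>.
  The trace formula rests on the irreducibility of the \<open>p\<close>-th cyclotomic polynomial, by which
  the Galois group acts simply transitively on the nontrivial \<open>p\<close>-th roots of unity.
\<close>

subsection \<open>Irreducibility of the prime cyclotomic polynomial\<close>

text \<open>If p divides the constant coefficient of one factor u, it does not divide that of the
  other factor v. At the least index i where p does not divide the coefficient of u, the product has
  a coefficient prime to p, so i is at least the degree of the product and v is constant. Only
  degrees are claimed, so constant factors that are not units do no harm.\<close>

lemma Eisenstein_criterion:
  fixes f g :: "int poly" and p :: int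
  assumes "prime p" and lead: "\<not> p dvd lead_coeff (f * g)"
    and low: "\<And>i. i < degree (f * g) \<Longrightarrow> p dvd coeff (f * g) i"
    and zero: "\<not> p\<^sup>2 dvd coeff (f * g) 0"
  shows "degree f = 0 \<or> degree g = 0"
proof -
  \<comment> \<open>The claim is symmetric in the product, so it serves for both orders of
    \<open>f\<close> and \<open>g\<close>.\<close>
  have main: "degree v = 0"
    if uv: "u * v = f * g" and u0: "p dvd coeff u 0" for u v :: "int poly"
  proof -
    have v0: "\<not> p dvd coeff v 0"
      using zero u0 unfolding uv [symmetric]
      by (auto simp: coeff_mult power2_eq_square intro: mult_dvd_mono)
    have "u * v \<noteq> 0" using zero uv by auto
    hence deg: "degree (u * v) = degree u + degree v"
      by (intro degree_mult_eq) auto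
    have "\<not> p dvd lead_coeff u" using lead unfolding uv [symmetric] by (auto simp: lead_coeff_mult)
    hence ex: "\<exists>i. \<not> p dvd coeff u i" by blast
    define i where "i = (LEAST i. \<not> p dvd coeff u i)"
    have i: "\<not> p dvd coeff u i" unfolding i_def using LeastI_ex [OF ex] .
    have below: "p dvd coeff u j" if "j < i" for j
      using not_less_Least that unfolding i_def by blast
    have "coeff (u * v) i = (\<Sum>j<i. coeff u j * coeff v (i - j)) + coeff u i * coeff v 0"
      by (simp add: coeff_mult lessThan_Suc_atMost [symmetric])
    moreover have "p dvd (\<Sum>j<i. coeff u j * coeff v (i - j))"
      by (intro dvd_sum dvd_mult2 below) auto
    moreover have "\<not> p dvd coeff u i * coeff v 0"
      using i v0 \<open>prime p\<close> by (simp add: prime_dvd_mult_iff)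
    ultimately have "\<not> p dvd coeff (u * v) i" by (simp add: dvd_add_right_iff)
    hence "degree (u * v) \<le> i" using low uv by (metis not_le)
    moreover have "i \<le> degree u" using i by (metis coeff_eq_0 dvd_0_right not_le)
    ultimately show ?thesis using deg by simp
  qed
  show ?thesis
  proof (cases "degree (f * g) = 0")
    case True
    have "f * g \<noteq> 0" using zero by auto
    then show ?thesis using True by (auto simp: degree_mult_eq)
  next
    case False
    hence "p dvd coeff f 0 * coeff g 0" using low [of 0] by (simp add: coeff_mult)
    hence "p dvd coeff f 0 \<or> p dvd coeff g 0" using \<open>prime p\<close> by (simp add: prime_dvd_mult_iff)
    then show ?thesis using main [of f g] main [of g f] by (auto simp: mult.commute)
  qed
qed

text \<open>For prime n this is the n-th cyclotomic polynomial. The coefficient ring is left open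
  because factorisations are studied over the integers and division with remainder over the
  rationals.\<close>

definition geometric_poly :: "nat \<Rightarrow> 'a::comm_ring_1 poly" where
  "geometric_poly n = (\<Sum>i<n. monom 1 i)"

lemma coeff_geometric_poly: "coeff (geometric_poly n) i = (if i < n then 1 else 0)"
  by (simp add: geometric_poly_def coeff_sum)

lemma degree_geometric_poly: "degree (geometric_poly n) = n - 1"
proof (cases n)
  case (Suc m)
  then show ?thesis by (intro antisym degree_le le_degree) (auto simp: coeff_geometric_poly)
qed (simp add: geometric_poly_def)

lemma geometric_poly_neq_0: "n > 0 \<Longrightarrow> geometric_poly n \<noteq> 0"
  by (auto simp: poly_eq_iff coeff_geometric_poly)

text \<open>Substituting X + 1 for X in (X - 1) G = X^n - 1 gives X G(X + 1) = (X + 1)^n - 1; the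
  factor X on the left shifts the index of the binomial coefficient by one.\<close>

lemma coeff_geometric_poly_shift:
  "coeff (geometric_poly n \<circ>\<^sub>p [:1, 1:]) i = (of_nat (n choose Suc i) :: 'a :: idom)"
proof -
  have "(monom 1 1 - 1) * geometric_poly n = (monom 1 n - 1 :: 'a poly)"
    using power_diff_1_eq [of "monom 1 1 :: 'a poly" n]
    by (simp add: geometric_poly_def monom_power)
  hence "(monom 1 1 \<circ>\<^sub>p [:1, 1:] - 1) * (geometric_poly n \<circ>\<^sub>p [:1, 1:])
      = monom 1 n \<circ>\<^sub>p [:1, 1:] - (1 :: 'a poly)"
    by (metis pcompose_diff pcompose_mult pcompose_1)
  moreover have "monom 1 n \<circ>\<^sub>p [:1, 1:] = ([:1, 1:] ^ n :: 'a poly)" for n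
    by (induction n) (simp_all add: monom_Suc pcompose_pCons monom_0 one_pCons)
  ultimately have "pCons 0 (geometric_poly n \<circ>\<^sub>p [:1, 1:]) = [:1, 1:] ^ n - (1 :: 'a poly)"
    by (simp add: one_pCons)
  hence "coeff (geometric_poly n \<circ>\<^sub>p [:1, 1:]) i = coeff ([:1, 1:] ^ n - 1 :: 'a poly) (Suc i)"
    by (metis coeff_pCons_Suc)
  also have "\<dots> = coeff ([:1, 1:] ^ n) (Suc i)"
    by simp
  also have "\<dots> = of_nat (n choose Suc i)"
    by (cases "Suc i \<le> n")
       (simp_all add: coeff_linear_poly_power coeff_eq_0 degree_linear_power binomial_eq_0)
  finally show ?thesis .
qed

text \<open>After the degree-preserving shift by 1 the coefficients are binomial: the leading one is
  1, the constant one is p, and all but the leading one are divisible by p, so Eisenstein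
  applies.\<close>

lemma geometric_poly_prime_factor:
  fixes f g :: "int poly"
  assumes "prime p" "geometric_poly p = f * g"
  shows "degree f = 0 \<or> degree g = 0"
proof -
  let ?s = "[:1, 1:] :: int poly"
  have p: "p > 1" using assms(1) by (rule prime_gt_1_nat)
  have eq: "(f \<circ>\<^sub>p ?s) * (g \<circ>\<^sub>p ?s) = geometric_poly p \<circ>\<^sub>p ?s"
    by (simp add: assms(2) pcompose_mult)
  have deg: "degree (geometric_poly p \<circ>\<^sub>p ?s) = p - 1"
    by (simp add: degree_pcompose degree_geometric_poly)
  have "degree (f \<circ>\<^sub>p ?s) = 0 \<or> degree (g \<circ>\<^sub>p ?s) = 0"
  proof (rule Eisenstein_criterion [where p = "int p"])
    show "prime (int p)" using assms(1) by simp
    show "\<not> int p dvd lead_coeff ((f \<circ>\<^sub>p ?s) * (g \<circ>\<^sub>p ?s))"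
      unfolding eq deg using p by (simp add: coeff_geometric_poly_shift)
    show "int p dvd coeff ((f \<circ>\<^sub>p ?s) * (g \<circ>\<^sub>p ?s)) i"
      if "i < degree ((f \<circ>\<^sub>p ?s) * (g \<circ>\<^sub>p ?s))" for i
      using that assms(1) unfolding eq deg by (auto simp: coeff_geometric_poly_shift intro!: dvd_choose_prime)
    show "\<not> (int p)\<^sup>2 dvd coeff ((f \<circ>\<^sub>p ?s) * (g \<circ>\<^sub>p ?s)) 0"
      unfolding eq coeff_geometric_poly_shift using p
      by (auto simp: power2_eq_square dest!: zdvd_imp_le)
  qed
  thus ?thesis by (simp add: degree_pcompose)
qed

section \<open>Evaluation of rational polynomials at complex numbers\<close>

definition poly_rat :: "rat poly \<Rightarrow> complex \<Rightarrow> complex" where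
  "poly_rat f z = poly (map_poly of_rat f) z"

lemma poly_rat_0 [simp]: "poly_rat 0 z = 0"
  by (simp add: poly_rat_def)

lemma poly_rat_pCons [simp]: "poly_rat (pCons c f) z = of_rat c + z * poly_rat f z"
  by (simp add: poly_rat_def map_poly_pCons)

lemma poly_rat_1 [simp]: "poly_rat 1 z = 1"
  by (simp add: one_pCons)

lemma poly_rat_add [simp]: "poly_rat (f + g) z = poly_rat f z + poly_rat g z"
proof -
  have "map_poly of_rat (f + g) = map_poly of_rat f + (map_poly of_rat g :: complex poly)"
    by (intro poly_eqI) (simp add: coeff_map_poly of_rat_add)
  thus ?thesis by (simp add: poly_rat_def)
qed

lemma poly_rat_smult [simp]: "poly_rat (smult c f) z = of_rat c * poly_rat f z"
  by (induction f) (simp_all add: algebra_simps of_rat_mult)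

lemma poly_rat_minus [simp]: "poly_rat (- f) z = - poly_rat f z"
  using poly_rat_smult [of "-1" f z] by (simp add: of_rat_minus)

lemma poly_rat_diff [simp]: "poly_rat (f - g) z = poly_rat f z - poly_rat g z"
  using poly_rat_add [of f "- g" z] by simp

lemma poly_rat_mult [simp]: "poly_rat (f * g) z = poly_rat f z * poly_rat g z"
  by (induction f) (simp_all add: algebra_simps)

lemma poly_rat_monom [simp]: "poly_rat (monom c n) z = of_rat c * z ^ n"
  by (simp add: poly_rat_def map_poly_monom poly_monom)

lemma poly_rat_sum [simp]: "poly_rat (sum f A) z = (\<Sum>i\<in>A. poly_rat (f i) z)"
  by (induction A rule: infinite_finite_induct) simp_all

lemma poly_rat_pcompose: "poly_rat (f \<circ>\<^sub>p g) z = poly_rat f (poly_rat g z)"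
  by (induction f) (simp_all add: pcompose_pCons)

lemma poly_rat_geometric_poly:
  assumes "z ^ n = 1" "z \<noteq> 1"
  shows "poly_rat (geometric_poly n) z = 0"
  using assms by (simp add: geometric_poly_def geometric_sum)

lemma poly_rat_of_int_poly_mult:
  "poly_rat (map_poly of_int (f * g)) z = poly_rat (map_poly of_int f) z * poly_rat (map_poly of_int g) z"
proof -
  have "map_poly of_int (f * g) = map_poly of_int f * (map_poly of_int g :: rat poly)"
    by (intro poly_eqI) (simp add: coeff_map_poly coeff_mult)
  thus ?thesis by simp
qed

lemma clear_denominators:
  fixes f :: "rat poly"
  obtains n :: int and g :: "int poly" where "n \<noteq> 0" "smult (of_int n) f = map_poly of_int g"
proof (induction f arbitrary: thesis rule: pCons_induct)
  case 0
  show ?case by (rule 0 [of 1 0]) simp_all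
next
  case (pCons a f)
  obtain n g where ng: "n \<noteq> 0" "smult (of_int n) f = map_poly of_int g" using pCons.IH by blast
  obtain k l where kl: "a = of_int k / of_int l" "l \<noteq> 0"
    by (metis Fract_of_int_quotient Rat_cases less_numeral_extra(3))
  have "smult (of_int (l * n)) (pCons a f) = pCons (of_int (l * n) * a) (smult (of_int l) (smult (of_int n) f))"
    by simp
  also have "\<dots> = map_poly of_int (pCons (n * k) (smult l g))"
    unfolding ng(2) using kl by (intro poly_eqI) (auto simp: coeff_map_poly coeff_pCons split: nat.split)
  finally show ?case using ng(1) kl(2) by (intro pCons.prems [of "l * n"]) auto
qed

text \<open>Descent on the degree: pseudo-division of G by \<open>h\<close> leaves a remainder that
  also vanishes at \<open>z\<close>. If it is nonzero, it is a smaller instance; if it is zero,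
  \<open>h\<close> divides a multiple of the irreducible G and has its full degree.\<close>

lemma degree_of_int_poly_root_ge:
  fixes h :: "int poly"
  assumes "prime p" "z ^ p = 1" "z \<noteq> 1" "h \<noteq> 0" "poly_rat (map_poly of_int h) z = 0"
  shows "p - 1 \<le> degree h"
  using assms(4,5)
proof (induction "degree h" arbitrary: h rule: less_induct)
  case less
  let ?G = "geometric_poly p :: int poly"
  obtain q r where qr: "pseudo_divmod ?G h = (q, r)" by force
  \<comment> \<open>This is the factor by which pseudo-division scales G to stay over the
    integers.\<close>
  define c where "c = lead_coeff h ^ (Suc (degree ?G) - degree h)"
  have c: "c \<noteq> 0" using less.prems by (simp add: c_def)
  have eq: "smult c ?G = h * q + r" and r: "r = 0 \<or> degree r < degree h"
    using pseudo_divmod [OF less.prems(1) qr] by (simp_all add: c_def)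
  have "poly_rat (map_poly of_int (smult c ?G)) z = 0"
  proof -
    have "map_poly of_int (smult c ?G) = smult (of_int c) (geometric_poly p :: rat poly)"
      by (intro poly_eqI) (simp add: coeff_map_poly coeff_geometric_poly)
    thus ?thesis using poly_rat_geometric_poly assms by simp
  qed
  moreover have "map_poly of_int (h * q + r) = map_poly of_int (h * q) + (map_poly of_int r :: rat poly)"
    by (intro poly_eqI) (simp add: coeff_map_poly)
  ultimately have rz: "poly_rat (map_poly of_int r) z = 0"
    using less.prems(2) by (simp add: eq poly_rat_of_int_poly_mult)
  show ?case
  proof (cases "r = 0")
    case False
    then show ?thesis using less.hyps [of r] r rz by auto
  next
    case True
    txt \<open>Gauss: comparing contents in \<open>c G = h q\<close> lets the constant \<open>c\<close> be cancelled, so \<open>G\<close>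
      factors over the integers with the same degrees.\<close>
    have "content (smult c ?G) = content h * content q" by (simp add: eq True content_mult)
    moreover have "content ?G = 1"
    proof -
      have "content ?G dvd 1"
        using content_dvd_coeff [of ?G 0] prime_gt_0_nat [OF assms(1)]
        by (simp add: coeff_geometric_poly)
      thus ?thesis unfolding is_unit_content_iff .
    qed
    ultimately have cont: "\<bar>c\<bar> = content h * content q" by simp
    have "smult c ?G = smult \<bar>c\<bar> (primitive_part h * primitive_part q)"
      using eq True unfolding cont
      by (metis add.right_neutral content_times_primitive_part mult_smult_left mult_smult_right smult_smult)
    also have "\<dots> = smult c (smult (sgn c) (primitive_part h * primitive_part q))"
      by (simp add: abs_sgn)
    finally have "?G = primitive_part h * smult (sgn c) (primitive_part q)"
      using c by (simp add: smult_cancel)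
    hence "degree h = 0 \<or> degree q = 0"
      using geometric_poly_prime_factor [OF assms(1), of "primitive_part h" "smult (sgn c) (primitive_part q)"] c
      by (simp add: sgn_0_0)
    moreover have "degree h \<noteq> 0"
    proof
      assume "degree h = 0"
      then obtain a where "h = [:a:]" by (rule degree_eq_zeroE)
      with less.prems show False by (simp add: map_poly_pCons)
    qed
    moreover have "degree h + degree q = p - 1"
    proof -
      have "q \<noteq> 0" using eq True c geometric_poly_neq_0 [OF prime_gt_0_nat [OF assms(1)]]
        by auto
      hence "degree (h * q) = degree h + degree q" using less.prems by (simp add: degree_mult_eq)
      moreover have "degree (smult c ?G) = p - 1" using c by (simp add: degree_geometric_poly)
      ultimately show ?thesis using eq True by simp
    qed
    ultimately show ?thesis by simp
  qed
qed

text \<open>All nontrivial p-th roots of unity share the minimal polynomial G: a nonzero remainder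
  modulo G would, with denominators cleared, be an integer polynomial of too small a degree
  vanishing at \<open>z\<close>.\<close>

lemma geometric_poly_dvd:
  assumes "prime p" "z ^ p = 1" "z \<noteq> 1" "poly_rat f z = 0"
  shows "geometric_poly p dvd f"
proof -
  let ?G = "geometric_poly p :: rat poly"
  have "?G \<noteq> 0" by (rule geometric_poly_neq_0) (rule prime_gt_0_nat [OF assms(1)])
  have "poly_rat (f mod ?G) z = poly_rat f z - poly_rat ?G z * poly_rat (f div ?G) z"
    unfolding poly_rat_mult [symmetric] poly_rat_diff [symmetric] by (simp add: minus_mult_div_eq_mod)
  hence r: "poly_rat (f mod ?G) z = 0"
    using assms by (simp add: poly_rat_geometric_poly)
  have "f mod ?G = 0"
  proof (rule ccontr)
    assume nz: "f mod ?G \<noteq> 0"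
    obtain n g where ng: "n \<noteq> 0" "smult (of_int n) (f mod ?G) = map_poly of_int g"
      using clear_denominators by blast
    have "poly_rat (map_poly of_int g) z = 0" using r by (simp flip: ng(2))
    moreover have "g \<noteq> 0" using ng nz by auto
    ultimately have "p - 1 \<le> degree g" using degree_of_int_poly_root_ge assms by blast
    moreover have "degree g = degree (f mod ?G)"
      using ng(1) arg_cong [OF ng(2), of degree] by (simp add: degree_map_poly)
    moreover have "degree (f mod ?G) < degree ?G"
      using degree_mod_less [OF \<open>?G \<noteq> 0\<close>] nz by blast
    ultimately show False by (simp add: degree_geometric_poly)
  qed
  thus ?thesis by auto
qed

text \<open>If f(z) is nonzero, so is the value of gcd(f, G) at z; hence the cofactor of the gcd in
  G vanishes at z and is divisible by G. The gcd is thus constant, and Bezout coefficients yield the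
  inverse.\<close>

lemma poly_rat_inverse:
  assumes "prime p" "z ^ p = 1" "z \<noteq> 1"
  obtains g where "poly_rat g z = inverse (poly_rat f z)"
proof (cases "poly_rat f z = 0")
  case True
  \<comment> \<open>The zero polynomial serves because \<open>inverse 0 = 0\<close>.\<close>
  then show ?thesis using that [of 0] by simp
next
  case False
  let ?G = "geometric_poly p :: rat poly"
  have "?G \<noteq> 0" by (rule geometric_poly_neq_0) (rule prime_gt_0_nat [OF assms(1)])
  obtain u v where uv: "u * f + v * ?G = gcd f ?G"
    using bezout_coefficients_fst_snd by blast
  obtain e where e: "?G = gcd f ?G * e" by (meson dvdE gcd_dvd2)
  have dz: "poly_rat (gcd f ?G) z = poly_rat u z * poly_rat f z"
    using assms by (simp add: poly_rat_geometric_poly flip: uv)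
  have dnz: "poly_rat (gcd f ?G) z \<noteq> 0"
  proof -
    obtain w where "f = gcd f ?G * w" by (meson dvdE gcd_dvd1)
    thus ?thesis using False by (metis mult_zero_left poly_rat_mult)
  qed
  have "poly_rat (gcd f ?G * e) z = 0"
    using poly_rat_geometric_poly [OF assms(2,3)] by (simp flip: e)
  hence "?G dvd e" using dnz geometric_poly_dvd [OF assms] by simp
  moreover have enz: "e \<noteq> 0" using e \<open>?G \<noteq> 0\<close> by auto
  ultimately have "degree ?G \<le> degree e" by (simp add: dvd_imp_degree_le)
  moreover have "degree ?G = degree (gcd f ?G) + degree e"
    using \<open>?G \<noteq> 0\<close> enz by (subst e) (simp add: degree_mult_eq)
  ultimately have "degree (gcd f ?G) = 0" by simp
  then obtain a where a: "gcd f ?G = [:a:]" by (rule degree_eq_zeroE)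
  have "of_rat a = poly_rat u z * poly_rat f z" "of_rat a \<noteq> (0::complex)" using dz dnz a by simp_all
  hence "poly_rat (smult (1 / a) u) z = inverse (poly_rat f z)"
    using False by (simp add: of_rat_divide field_simps)
  thus ?thesis by (rule that)
qed

subsection \<open>The Galois group and the trace\<close>

lemma bij_betw_zeta_powers:
  assumes "p > 0"
  shows "bij_betw (\<lambda>k. zeta p ^ k) {..<p} {z. z ^ p = 1}"
proof -
  have "zeta p ^ k = cis (2 * pi * real k / real p)" for k
    by (simp add: zeta_def cis_conv_exp exp_of_nat_mult [symmetric] mult_ac)
  thus ?thesis using bij_betw_roots_unity [OF assms] by simp
qed

lemma zeta_power_eq_1: "p > 0 \<Longrightarrow> zeta p ^ p = 1"
  by (simp add: zeta_def exp_of_nat_mult [symmetric])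

lemma bij_betw_zeta_powers_neq_1:
  assumes "p > 0"
  shows "bij_betw (\<lambda>k. zeta p ^ k) {1..p-1} {z. z ^ p = 1 \<and> z \<noteq> 1}"
proof -
  have "bij_betw (\<lambda>k. zeta p ^ k) ({..<p} - {0}) ({z. z ^ p = 1} - {zeta p ^ 0})"
    using bij_betw_zeta_powers [OF assms] assms by (intro bij_betw_DiffI) auto
  moreover have "{..<p} - {0} = {1..p-1}" using assms by auto
  moreover have "{z. z ^ p = 1} - {zeta p ^ 0} = {z. z ^ p = 1 \<and> z \<noteq> 1}" by auto
  ultimately show ?thesis by simp
qed

lemma nontrivial_root_of_unityE:
  assumes "p > 0" "z ^ p = 1" "z \<noteq> 1"
  obtains k where "k \<in> {1..p-1}" "z = zeta p ^ k"
proof -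
  have "z \<in> (\<lambda>k. zeta p ^ k) ` {1..p-1}"
    unfolding bij_betw_imp_surj_on [OF bij_betw_zeta_powers_neq_1 [OF assms(1)]] using assms by simp
  thus ?thesis using that by blast
qed

lemma zeta_neq_1:
  assumes "p > 1"
  shows "zeta p \<noteq> 1"
proof
  assume "zeta p = 1"
  hence "zeta p ^ 0 = zeta p ^ 1" by simp
  moreover have "inj_on (\<lambda>k. zeta p ^ k) {..<p}"
    using bij_betw_zeta_powers [of p] assms by (simp add: bij_betw_def)
  ultimately show False using inj_onD [of "\<lambda>k. zeta p ^ k" "{..<p}" 0 1] assms by simp
qed

section \<open>The cyclotomic field as the set of polynomial values at zeta\<close>

lemma inv_ring_of_type_algebra:
  "x \<noteq> 0 \<Longrightarrow> inv\<^bsub>ring_of_type_algebra\<^esub> x = inverse (x :: 'a :: field)"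
proof -
  interpret R: Ring.field "ring_of_type_algebra :: 'a ring" by (rule field_from_type_algebra)
  show "x \<noteq> 0 \<Longrightarrow> inv\<^bsub>ring_of_type_algebra\<^esub> x = inverse x"
    by (rule R.comm_inv_char) (auto simp: ring_of_type_algebra_def)
qed

lemma a_inv_ring_of_type_algebra:
  "\<ominus>\<^bsub>ring_of_type_algebra\<^esub> x = - (x :: 'a :: field)"
proof -
  interpret R: Ring.field "ring_of_type_algebra :: 'a ring" by (rule field_from_type_algebra)
  show ?thesis
    by (rule R.sum_zero_eq_neg [symmetric]) (auto simp: ring_of_type_algebra_def)
qed

text \<open>Polynomial values at zeta are closed under the field operations, inverses being the only
  hard case. This gives every field element a form on which automorphisms can be evaluated.\<close>

lemma carrier_cyclotomic_field:
  assumes "prime p"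
  shows "carrier (cyclotomic_field p) = range (\<lambda>f. poly_rat f (zeta p))"
proof (intro antisym subsetI)
  note root = zeta_power_eq_1 [OF prime_gt_0_nat [OF assms]] zeta_neq_1 [OF prime_gt_1_nat [OF assms]]
  fix x assume "x \<in> carrier (cyclotomic_field p)"
  hence "x \<in> generate_field ring_of_type_algebra (\<rat> \<union> {zeta p})"
    by (simp add: cyclotomic_field_def)
  thus "x \<in> range (\<lambda>f. poly_rat f (zeta p))"
  proof induction
    case one
    show ?case by (rule range_eqI [of _ _ 1]) (simp add: ring_of_type_algebra_def)
  next
    case (incl h)
    then consider c where "h = of_rat c" | "h = zeta p" by (auto elim: Rats_cases)
    then show ?case
    proof cases
      case 1
      then show ?thesis by (intro range_eqI [of _ _ "[:c:]"]) simp
    next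
      case 2
      then show ?thesis by (intro range_eqI [of _ _ "[:0, 1:]"]) simp
    qed
  next
    case (a_inv h)
    then show ?case
      by (auto simp: a_inv_ring_of_type_algebra simp flip: poly_rat_minus)
  next
    case (m_inv h)
    then obtain f where f: "h = poly_rat f (zeta p)" by blast
    have "h \<noteq> 0" using m_inv by (simp add: ring_of_type_algebra_def)
    moreover obtain g where "poly_rat g (zeta p) = inverse h"
      using poly_rat_inverse [OF assms root] unfolding f by blast
    ultimately show ?case by (metis inv_ring_of_type_algebra rangeI)
  next
    case (eng_add h1 h2)
    then show ?case by (auto simp: ring_of_type_algebra_def simp flip: poly_rat_add)
  next
    case (eng_mult h1 h2)
    then show ?case by (auto simp: ring_of_type_algebra_def simp flip: poly_rat_mult)
  qed
next
  let ?K = "generate_field (ring_of_type_algebra :: complex ring) (\<rat> \<union> {zeta p})"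
  have add: "x + y \<in> ?K" if "x \<in> ?K" "y \<in> ?K" for x y
    using generate_field.eng_add [OF that] by (simp add: ring_of_type_algebra_def)
  have mult: "x * y \<in> ?K" if "x \<in> ?K" "y \<in> ?K" for x y
    using generate_field.eng_mult [OF that] by (simp add: ring_of_type_algebra_def)
  have "poly_rat f (zeta p) \<in> ?K" for f
  proof (induction f rule: pCons_induct)
    case 0
    show ?case by (rule generate_field.incl) simp
  next
    case (pCons a f)
    moreover have "of_rat a \<in> ?K" "zeta p \<in> ?K"
      by (auto intro: generate_field.incl)
    ultimately show ?case unfolding poly_rat_pCons by (intro add mult)
  qed
  thus "x \<in> carrier (cyclotomic_field p)" if "x \<in> range (\<lambda>f. poly_rat f (zeta p))" for x
    using that by (auto simp: cyclotomic_field_def)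
qed

lemma cyclotomic_field_simps [simp]:
  "x \<otimes>\<^bsub>cyclotomic_field p\<^esub> y = x * y" "x \<oplus>\<^bsub>cyclotomic_field p\<^esub> y = x + y"
  "\<one>\<^bsub>cyclotomic_field p\<^esub> = 1"
  by (simp_all add: cyclotomic_field_def ring_of_type_algebra_def)

section \<open>Automorphisms of the cyclotomic field\<close>

lemma cyclotomic_gal_iff:
  "\<sigma> \<in> cyclotomic_gal p \<longleftrightarrow>
     bij_betw \<sigma> (carrier (cyclotomic_field p)) (carrier (cyclotomic_field p)) \<and>
     (\<forall>x\<in>carrier (cyclotomic_field p). \<forall>y\<in>carrier (cyclotomic_field p).
        \<sigma> (x * y) = \<sigma> x * \<sigma> y \<and> \<sigma> (x + y) = \<sigma> x + \<sigma> y) \<and>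
     \<sigma> \<in> extensional (carrier (cyclotomic_field p)) \<and> (\<forall>q\<in>\<rat>. \<sigma> q = q)"
  by (auto simp: cyclotomic_gal_def ring_iso_def ring_hom_def bij_betw_def)

lemma cyclotomic_gal_poly_rat:
  assumes "prime p" "\<sigma> \<in> cyclotomic_gal p"
  shows "\<sigma> (poly_rat f (zeta p)) = poly_rat f (\<sigma> (zeta p))"
proof (induction f rule: pCons_induct)
  case 0
  have "\<sigma> 0 = 0" using assms(2) by (auto simp: cyclotomic_gal_iff)
  then show ?case by simp
next
  case (pCons a f)
  have K: "poly_rat g (zeta p) \<in> carrier (cyclotomic_field p)" for g
    by (simp add: carrier_cyclotomic_field [OF assms(1)])
  have mem: "of_rat a \<in> carrier (cyclotomic_field p)" "zeta p \<in> carrier (cyclotomic_field p)"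
    using K [of "[:a:]"] K [of "[:0, 1:]"] by simp_all
  have "zeta p * poly_rat f (zeta p) \<in> carrier (cyclotomic_field p)"
    using K [of "[:0, 1:] * f"] by simp
  with mem K [of f] pCons assms(2) show ?case by (simp add: cyclotomic_gal_iff)
qed

text \<open>The exponent k with w = zeta^k is prime to p, hence invertible modulo p.\<close>

lemma primitive_root_power_inverse:
  assumes "prime p" "w ^ p = 1" "w \<noteq> 1"
  obtains l where "zeta p = w ^ l"
proof -
  have p: "p > 1" using assms(1) by (rule prime_gt_1_nat)
  obtain k where k: "k \<in> {1..p-1}" "w = zeta p ^ k"
    using nontrivial_root_of_unityE [of p w] assms p by auto
  hence "\<not> p dvd k" by (auto dest: dvd_imp_le)
  hence "gcd k p = 1"
    using prime_imp_coprime [OF assms(1)] by (metis coprime_commute coprime_imp_gcd_eq_1)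
  then obtain x y where "k * x = p * y + 1" using bezout_nat [of k p] k by auto
  hence "w ^ x = zeta p"
    using zeta_power_eq_1 [of p] p by (simp add: k(2) power_mult [symmetric]) (simp add: power_mult)
  thus ?thesis using that by metis
qed

text \<open>The map sending f(zeta) to f(w) is well defined and injective because zeta and
  \<open>w\<close> have the same minimal polynomial, and surjective because zeta is a power of
  \<open>w\<close>.\<close>

lemma cyclotomic_gal_exists:
  assumes p: "prime p" and w: "w ^ p = 1" "w \<noteq> 1"
  obtains \<sigma> where "\<sigma> \<in> cyclotomic_gal p" "\<sigma> (zeta p) = w"
proof -
  note root = zeta_power_eq_1 [OF prime_gt_0_nat [OF p]] zeta_neq_1 [OF prime_gt_1_nat [OF p]]
  let ?K = "carrier (cyclotomic_field p)"
  note K = carrier_cyclotomic_field [OF p]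
  \<comment> \<open>Read from zeta to \<open>w\<close> this gives well-definedness, from
    \<open>w\<close> to zeta injectivity.\<close>
  have transfer: "poly_rat f z = poly_rat g z"
    if "poly_rat f y = poly_rat g y" "y ^ p = 1" "y \<noteq> 1" "z ^ p = 1" "z \<noteq> 1" for f g y z
  proof -
    have "geometric_poly p dvd f - g"
      using geometric_poly_dvd [OF p that(2,3)] that(1) by simp
    then obtain h where "f - g = geometric_poly p * h" by (elim dvdE)
    hence "poly_rat (f - g) z = 0" using poly_rat_geometric_poly that by simp
    thus ?thesis by simp
  qed
  \<comment> \<open>The representing polynomial is chosen arbitrarily; \<open>restrict\<close> makes
    the map extensional, as membership in \<open>cyclotomic_gal\<close> demands.\<close>
  define \<sigma> where "\<sigma> = restrict (\<lambda>x. poly_rat (SOME f. poly_rat f (zeta p) = x) w) ?K"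
  have \<sigma>: "\<sigma> (poly_rat f (zeta p)) = poly_rat f w" for f
  proof -
    have "poly_rat (SOME g. poly_rat g (zeta p) = poly_rat f (zeta p)) (zeta p) = poly_rat f (zeta p)"
      by (rule someI [of _ f]) simp
    hence "poly_rat (SOME g. poly_rat g (zeta p) = poly_rat f (zeta p)) w = poly_rat f w"
      by (rule transfer [OF _ root w])
    thus ?thesis by (simp add: \<sigma>_def K)
  qed
  have \<sigma>_rat: "\<sigma> q = q" if "q \<in> \<rat>" for q
  proof -
    obtain c where "q = of_rat c" using \<open>q \<in> \<rat>\<close> by (rule Rats_cases)
    thus ?thesis using \<sigma> [of "[:c:]"] by simp
  qed
  have inj: "inj_on \<sigma> ?K"
  proof (rule inj_onI)
    fix x y assume "x \<in> ?K" "y \<in> ?K" and eq: "\<sigma> x = \<sigma> y"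
    then obtain f g where fg: "x = poly_rat f (zeta p)" "y = poly_rat g (zeta p)" unfolding K by blast
    show "x = y" using eq unfolding fg \<sigma> by (rule transfer [OF _ w root])
  qed
  obtain l where l: "zeta p = w ^ l" using primitive_root_power_inverse [OF p w] .
  have "\<sigma> ` ?K = ?K"
  proof -
    obtain k where k: "k \<in> {1..p-1}" "w = zeta p ^ k"
      using nontrivial_root_of_unityE [OF prime_gt_0_nat [OF p] w] .
    have "poly_rat f w \<in> ?K" for f
      unfolding K k(2) by (rule range_eqI [of _ _ "f \<circ>\<^sub>p monom 1 k"]) (simp add: poly_rat_pcompose)
    moreover have "poly_rat f (zeta p) \<in> \<sigma> ` ?K" for f
    proof -
      have "poly_rat f (zeta p) = poly_rat (f \<circ>\<^sub>p monom 1 l) w"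
        by (simp add: poly_rat_pcompose l)
      also have "\<dots> = \<sigma> (poly_rat (f \<circ>\<^sub>p monom 1 l) (zeta p))"
        by (rule \<sigma> [symmetric])
      finally show ?thesis unfolding K by blast
    qed
    ultimately show ?thesis unfolding K by (auto simp: \<sigma>)
  qed
  with inj have "bij_betw \<sigma> ?K ?K" by (simp add: bij_betw_def)
  moreover have "\<sigma> (x * y) = \<sigma> x * \<sigma> y \<and> \<sigma> (x + y) = \<sigma> x + \<sigma> y" if xy: "x \<in> ?K" "y \<in> ?K" for x y
  proof -
    obtain f g where fg: "x = poly_rat f (zeta p)" "y = poly_rat g (zeta p)"
      using xy unfolding K by blast
    show ?thesis using \<sigma> [of "f * g"] \<sigma> [of "f + g"] by (simp add: fg \<sigma>)
  qed
  moreover have "\<sigma> \<in> extensional ?K" by (simp add: \<sigma>_def)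
  ultimately have "\<sigma> \<in> cyclotomic_gal p" by (simp add: cyclotomic_gal_iff \<sigma>_rat)
  moreover have "\<sigma> (zeta p) = w" using \<sigma> [of "[:0, 1:]"] by simp
  ultimately show ?thesis by (rule that)
qed

text \<open>An automorphism is determined by its value at zeta, and extensionality turns agreement
  on the field into equality of functions. Sums over the group thereby become sums over roots of
  unity.\<close>

lemma bij_betw_cyclotomic_gal:
  assumes p: "prime p"
  shows "bij_betw (\<lambda>\<sigma>. \<sigma> (zeta p)) (cyclotomic_gal p) {z. z ^ p = 1 \<and> z \<noteq> 1}"
  unfolding bij_betw_def
proof (intro conjI inj_onI antisym subsetI)
  note K = carrier_cyclotomic_field [OF p]
  note eval = cyclotomic_gal_poly_rat [OF p]
  note root = zeta_power_eq_1 [OF prime_gt_0_nat [OF p]] zeta_neq_1 [OF prime_gt_1_nat [OF p]]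
  show "\<sigma> = \<tau>" if "\<sigma> \<in> cyclotomic_gal p" "\<tau> \<in> cyclotomic_gal p" "\<sigma> (zeta p) = \<tau> (zeta p)" for \<sigma> \<tau>
  proof (rule extensionalityI)
    show "\<sigma> \<in> extensional (carrier (cyclotomic_field p))" "\<tau> \<in> extensional (carrier (cyclotomic_field p))"
      using that by (simp_all add: cyclotomic_gal_iff)
    fix x assume "x \<in> carrier (cyclotomic_field p)"
    then obtain f where "x = poly_rat f (zeta p)" unfolding K by blast
    thus "\<sigma> x = \<tau> x" by (simp only: eval [OF that(1)] eval [OF that(2)] that(3))
  qed
  fix z :: complex
  {
    assume "z \<in> (\<lambda>\<sigma>. \<sigma> (zeta p)) ` cyclotomic_gal p"
    then obtain \<sigma> where \<sigma>: "\<sigma> \<in> cyclotomic_gal p" "z = \<sigma> (zeta p)" by blast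
    have "\<sigma> 1 = 1" using \<sigma>(1) by (simp add: cyclotomic_gal_iff)
    moreover have "z ^ p = \<sigma> (zeta p ^ p)" using eval [OF \<sigma>(1), of "monom 1 p"] \<sigma>(2) by simp
    moreover have "inj_on \<sigma> (carrier (cyclotomic_field p))"
      using \<sigma>(1) by (simp add: cyclotomic_gal_iff bij_betw_def)
    moreover have "poly_rat [:0, 1:] (zeta p) \<in> carrier (cyclotomic_field p)"
       "poly_rat 1 (zeta p) \<in> carrier (cyclotomic_field p)"
      unfolding K by blast+
    \<comment> \<open>The image of zeta differs from 1 because 1 is already the image of 1.\<close>
    ultimately show "z \<in> {z. z ^ p = 1 \<and> z \<noteq> 1}" using root \<sigma>(2)
      by (auto dest: inj_onD [where x = "zeta p" and y = 1])
  next
    assume "z \<in> {z. z ^ p = 1 \<and> z \<noteq> 1}"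
    then obtain \<sigma> where "\<sigma> \<in> cyclotomic_gal p" "\<sigma> (zeta p) = z"
      using cyclotomic_gal_exists [OF p, of z] by blast
    thus "z \<in> (\<lambda>\<sigma>. \<sigma> (zeta p)) ` cyclotomic_gal p" by blast
  }
qed

section \<open>Traces in integer coordinates\<close>

lemma cyclotomic_trace_poly_rat:
  assumes "prime p"
  shows "cyclotomic_trace p (poly_rat f (zeta p)) = (\<Sum>k=1..p-1. poly_rat f (zeta p ^ k))"
proof -
  have "cyclotomic_trace p (poly_rat f (zeta p)) = (\<Sum>\<sigma>\<in>cyclotomic_gal p. poly_rat f (\<sigma> (zeta p)))"
    using cyclotomic_gal_poly_rat [OF assms] by (simp add: cyclotomic_trace_def)
  also have "\<dots> = (\<Sum>z | z ^ p = 1 \<and> z \<noteq> 1. poly_rat f z)"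
    by (rule sum.reindex_bij_betw [OF bij_betw_cyclotomic_gal [OF assms]])
  also have "\<dots> = (\<Sum>k=1..p-1. poly_rat f (zeta p ^ k))"
    by (rule sum.reindex_bij_betw [OF bij_betw_zeta_powers_neq_1, symmetric])
       (rule prime_gt_0_nat [OF assms])
  finally show ?thesis .
qed

text \<open>With the term k = 0 added this is a full geometric sum of a p-th root of unity, which
  vanishes unless that root is 1; the added term accounts for the -1.\<close>

lemma sum_zeta_powers:
  assumes "prime p"
  shows "(\<Sum>k=1..p-1. (zeta p ^ k) ^ j) = (if p dvd j then of_nat p - 1 else -1)"
proof -
  have p: "p > 1" using assms by (rule prime_gt_1_nat)
  have swap: "(zeta p ^ k) ^ j = (zeta p ^ j) ^ k" for k by (metis mult.commute power_mult)
  have "{..<p} = insert 0 {1..p-1}" using p by auto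
  hence split: "(\<Sum>k<p. (zeta p ^ j) ^ k) = 1 + (\<Sum>k=1..p-1. (zeta p ^ j) ^ k)" by simp
  show ?thesis
  proof (cases "p dvd j")
    case True
    hence "zeta p ^ j = 1" using zeta_power_eq_1 [of p] p by (auto simp: power_mult)
    thus ?thesis using True p by (simp add: swap)
  next
    case False
    have "zeta p ^ j = zeta p ^ (j mod p)"
      using zeta_power_eq_1 [of p] p
      by (metis mult_div_mod_eq mult_1 power_add power_mult power_one order_less_trans zero_less_one)
    moreover have "j mod p \<in> {1..p-1}"
      using False p by (simp add: Suc_le_eq less_Suc_eq_le [symmetric] mod_greater_zero_iff_not_dvd)
    ultimately have neq: "zeta p ^ j \<noteq> 1"
      using bij_betw_imp_surj_on [OF bij_betw_zeta_powers_neq_1 [of p]] p by blast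
    have "(zeta p ^ j) ^ p = 1"
      using zeta_power_eq_1 [of p] p by (metis mult.commute order_less_trans power_mult power_one zero_less_one)
    hence "(\<Sum>k<p. (zeta p ^ j) ^ k) = 0" using neq by (simp add: geometric_sum)
    thus ?thesis using False split by (simp add: swap eq_neg_iff_add_eq_0 add.commute)
  qed
qed

definition zeta_sum :: "nat \<Rightarrow> (nat \<Rightarrow> int) \<Rightarrow> complex" where
  "zeta_sum p a = (\<Sum>j=1..p-1. of_int (a j) * zeta p ^ j)"

lemma cyclotomic_trace_zeta_sum:
  assumes "prime p" "k \<in> {1..p-1}"
  shows "cyclotomic_trace p (zeta_sum p a * zeta p ^ k)
         = of_int (int p * a (p - k) - (\<Sum>j=1..p-1. a j))"
proof -
  have p: "p > 1" using assms(1) by (rule prime_gt_1_nat)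
  define f where "f = (\<Sum>j=1..p-1. monom (of_int (a j) :: rat) (j + k))"
  have "zeta_sum p a * zeta p ^ k = poly_rat f (zeta p)"
    by (simp add: zeta_sum_def f_def sum_distrib_right power_add mult.assoc)
  hence "cyclotomic_trace p (zeta_sum p a * zeta p ^ k) = (\<Sum>l=1..p-1. poly_rat f (zeta p ^ l))"
    using cyclotomic_trace_poly_rat [OF assms(1)] by simp
  also have "\<dots> = (\<Sum>j=1..p-1. of_int (a j) * (\<Sum>l=1..p-1. (zeta p ^ l) ^ (j + k)))"
    unfolding f_def by (simp add: sum_distrib_left) (rule sum.swap)
  also have "\<dots> = (\<Sum>j=1..p-1. (if j = p - k then of_int (int p * a j) else 0) - of_int (a j))"
  proof (rule sum.cong)
    fix j assume j: "j \<in> {1..p-1}"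
    have "p dvd j + k \<longleftrightarrow> j = p - k"
    proof
      assume "p dvd j + k"
      then obtain m where m: "j + k = p * m" by (elim dvdE)
      \<comment> \<open>The only multiple of p strictly between 0 and 2p is p itself.\<close>
      have "0 < j + k" "j + k < p * 2" using j assms(2) by auto
      hence "m = 1" unfolding m by simp
      thus "j = p - k" using m by simp
    qed (use assms(2) in auto)
    thus "of_int (a j) * (\<Sum>l=1..p-1. (zeta p ^ l) ^ (j + k))
        = (if j = p - k then of_int (int p * a j) else 0) - (of_int (a j) :: complex)"
      unfolding sum_zeta_powers [OF assms(1)] by (auto simp: algebra_simps)
  qed simp
  also have "\<dots> = of_int (int p * a (p - k) - (\<Sum>j=1..p-1. a j))"
  proof -
    have "p - k \<in> {1..p-1}" using assms(2) by auto
    thus ?thesis by (simp add: sum_subtractf)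
  qed
  finally show ?thesis .
qed

text \<open>The trace against \<open>zeta p ^ (p - j)\<close> recovers p a_j - s, where s is the sum
  of all a_i. Summing over the p - 1 indices gives p s - (p - 1) s = s, so s and then each a_j is
  determined.\<close>

lemma zeta_sum_inject:
  assumes "prime p" "zeta_sum p a = zeta_sum p b" "j \<in> {1..p-1}"
  shows "a j = b j"
proof -
  have eq: "int p * a j - (\<Sum>j=1..p-1. a j) = int p * b j - (\<Sum>j=1..p-1. b j)" if "j \<in> {1..p-1}" for j
  proof -
    have k: "p - j \<in> {1..p-1}" "p - (p - j) = j" using that by auto
    show ?thesis
      using cyclotomic_trace_zeta_sum [OF assms(1) k(1), of a]
        cyclotomic_trace_zeta_sum [OF assms(1) k(1), of b]
      unfolding assms(2) k(2) of_int_eq_iff [symmetric, where 'a = complex] by simp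
  qed
  have p: "p > 1" using assms(1) by (rule prime_gt_1_nat)
  have "(\<Sum>j=1..p-1. int p * a j - (\<Sum>j=1..p-1. a j)) = (\<Sum>j=1..p-1. int p * b j - (\<Sum>j=1..p-1. b j))"
    by (intro sum.cong eq) auto
  hence "(\<Sum>j=1..p-1. a j) = (\<Sum>j=1..p-1. b j)"
    using p by (simp add: sum_subtractf algebra_simps flip: sum_distrib_left)
  with eq [OF assms(3)] p show ?thesis by simp
qed

subsection \<open>The trace form\<close>

text \<open>The bilinear form behind \<open>trace_norm\<close>: the sum over k of Tr(\<alpha>
  \<omega>^k) Tr(\<beta> \<omega>^k), in coordinates and reindexed by j = p - k.\<close>

definition trace_form :: "nat \<Rightarrow> (nat \<Rightarrow> int) \<Rightarrow> (nat \<Rightarrow> int) \<Rightarrow> real" where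
  "trace_form p a b = (\<Sum>j=1..p-1. real_of_int (int p * a j - (\<Sum>i=1..p-1. a i)) *
                                  real_of_int (int p * b j - (\<Sum>i=1..p-1. b i)))"

lemma trace_form_eq:
  assumes "p > 0"
  shows "trace_form p a b = (real p)\<^sup>2 * (\<Sum>j=1..p-1. real_of_int (a j) * real_of_int (b j))
    - (real p + 1) * (\<Sum>j=1..p-1. real_of_int (a j)) * (\<Sum>j=1..p-1. real_of_int (b j))"
proof -
  define A where "A = (\<Sum>j=1..p-1. real_of_int (a j))"
  define B where "B = (\<Sum>j=1..p-1. real_of_int (b j))"
  have "trace_form p a b = (\<Sum>j=1..p-1. (real p)\<^sup>2 * (real_of_int (a j) * real_of_int (b j))
      - real p * B * real_of_int (a j) - real p * A * real_of_int (b j) + A * B)"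
    unfolding trace_form_def by (intro sum.cong) (simp_all add: A_def B_def power2_eq_square algebra_simps)
  also have "\<dots> = (real p)\<^sup>2 * (\<Sum>j=1..p-1. real_of_int (a j) * real_of_int (b j))
      - real p * B * A - real p * A * B + real (p - 1) * (A * B)"
    by (simp add: sum.distrib sum_subtractf A_def B_def flip: sum_distrib_left)
  also have "real (p - 1) = real p - 1" using assms by simp
  finally show ?thesis by (simp add: A_def B_def algebra_simps)
qed

lemma trace_form_nonneg: "trace_form p a a \<ge> 0"
  unfolding trace_form_def by (intro sum_nonneg) (simp flip: power2_eq_square)

lemma trace_norm_zeta_sum:
  assumes "prime p"
  shows "trace_norm p (zeta_sum p a) = sqrt (trace_form p a a)"
proof -
  have "(\<Sum>j=1..p-1. (Re (cyclotomic_trace p (zeta_sum p a * zeta p ^ j)))\<^sup>2)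
      = (\<Sum>j=1..p-1. (real_of_int (int p * a (p - j) - (\<Sum>i=1..p-1. a i)))\<^sup>2)"
    by (intro sum.cong refl) (simp add: cyclotomic_trace_zeta_sum [OF assms])
  also have "\<dots> = trace_form p a a"
    unfolding trace_form_def power2_eq_square
    by (rule sum.reindex_bij_witness [of _ "\<lambda>j. p - j" "\<lambda>j. p - j"]) auto
  finally show ?thesis by (simp add: trace_norm_def)
qed

text \<open>Polarisation turns the law of cosines into the form, and the normalising factor of the
  distance cancels. If a norm vanishes, both sides are 0 by the convention for division by
  zero.\<close>

lemma cyc_cos_angle_zeta_sum:
  assumes "prime p" "N > 0"
  shows "cyc_cos_angle p N (zeta_sum p a) 0 (zeta_sum p b) =
    trace_form p a b / (sqrt (trace_form p a a) * sqrt (trace_form p b b))"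
proof -
  have p: "p > 1" using assms(1) by (rule prime_gt_1_nat)
  define D where "D = 2 * real_of_int N * real p * sqrt (real p - 1)"
  have D: "D > 0" using p assms(2) by (simp add: D_def)
  have diff: "zeta_sum p b - zeta_sum p a = zeta_sum p (\<lambda>j. b j - a j)"
    by (simp add: zeta_sum_def sum_subtractf algebra_simps)
  have "trace_form p (\<lambda>j. b j - a j) (\<lambda>j. b j - a j)
      = trace_form p a a + trace_form p b b - 2 * trace_form p a b"
    unfolding trace_form_def sum_distrib_left sum.distrib [symmetric] sum_subtractf [symmetric]
    by (intro sum.cong) (simp_all add: sum_subtractf algebra_simps)
  thus ?thesis
    using D trace_form_nonneg [of p a] trace_form_nonneg [of p b] trace_form_nonneg [of p "\<lambda>j. b j - a j"]
    by (simp add: cyc_cos_angle_def cyc_dist_def diff trace_norm_zeta_sum [OF assms(1)] power_divide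
        flip: D_def add_divide_distrib diff_divide_distrib) (simp add: power2_eq_square)
qed

subsection \<open>Second moments over the vertices\<close>

text \<open>The second moment of a sum of independent signs: adding one coordinate pairs each vector
  with its two extensions, whose cross terms cancel.\<close>

lemma sum_PiE_signs_power2:
  fixes c :: "'i \<Rightarrow> real" and N :: int
  assumes "finite A" "N \<noteq> 0"
  shows "(\<Sum>b\<in>PiE A (\<lambda>_. {-N, N}). (\<Sum>j\<in>A. c j * real_of_int (b j))\<^sup>2)
    = 2 ^ card A * (real_of_int N)\<^sup>2 * (\<Sum>j\<in>A. (c j)\<^sup>2)"
  using assms(1)
proof (induction A rule: finite_induct)
  case empty
  then show ?case by simp
next
  case (insert x A)
  let ?L = "\<lambda>b. \<Sum>j\<in>A. c j * real_of_int (b j)"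
  have inj: "inj_on (\<lambda>(y, g). g(x := y)) ({-N, N} \<times> PiE A (\<lambda>_. {-N, N}))"
    using inj_combinator [OF insert.hyps(2), of "\<lambda>_. {-N, N}"] .
  have L: "?L (b(x := y)) = ?L b" for b y
    using insert.hyps by (intro sum.cong) auto
  have "(\<Sum>b\<in>PiE (insert x A) (\<lambda>_. {-N, N}). (\<Sum>j\<in>insert x A. c j * real_of_int (b j))\<^sup>2)
      = (\<Sum>y\<in>{-N, N}. \<Sum>b\<in>PiE A (\<lambda>_. {-N, N}). (c x * real_of_int y + ?L b)\<^sup>2)"
    unfolding PiE_insert_eq sum.reindex [OF inj] sum.cartesian_product
    using insert.hyps by (intro sum.cong) (auto simp: L fun_upd_same simp del: fun_upd_apply)
  \<comment> \<open>The two signs are distinct summands because N is nonzero.\<close>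
  also have "\<dots> = (\<Sum>b\<in>PiE A (\<lambda>_. {-N, N}). (c x * real_of_int (-N) + ?L b)\<^sup>2 + (c x * real_of_int N + ?L b)\<^sup>2)"
    using assms(2) by (simp add: sum.distrib)
  also have "\<dots> = (\<Sum>b\<in>PiE A (\<lambda>_. {-N, N}). 2 * (real_of_int N)\<^sup>2 * (c x)\<^sup>2 + 2 * (?L b)\<^sup>2)"
    by (intro sum.cong) (simp_all add: power2_eq_square algebra_simps)
  also have "\<dots> = real (card (PiE A (\<lambda>_. {-N, N}))) * (2 * (real_of_int N)\<^sup>2 * (c x)\<^sup>2)
      + 2 * (2 ^ card A * (real_of_int N)\<^sup>2 * (\<Sum>j\<in>A. (c j)\<^sup>2))"
    using insert.IH by (simp add: sum.distrib flip: sum_distrib_left)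
  also have "card (PiE A (\<lambda>_. {-N, N})) = 2 ^ card A"
    using insert.hyps(1) assms(2) by (simp add: card_PiE numeral_2_eq_2)
  finally show ?case using insert.hyps by (simp add: algebra_simps)
qed

lemma Markov_card:
  fixes f :: "'a \<Rightarrow> real"
  assumes "finite A" "\<And>x. x \<in> A \<Longrightarrow> f x \<ge> 0"
  shows "real (card {x \<in> A. f x > t}) * t \<le> sum f A"
proof -
  have "real (card {x \<in> A. f x > t}) * t = (\<Sum>x\<in>{x \<in> A. f x > t}. t)" by simp
  also have "\<dots> \<le> sum f {x \<in> A. f x > t}" by (intro sum_mono) auto
  also have "\<dots> \<le> sum f A" using assms by (intro sum_mono2) auto
  finally show ?thesis .
qed

text \<open>Proportions of vertices become proportions of sign vectors. \<open>PiE\<close> fixes the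
  values outside the index range, which injectivity of \<open>zeta_sum p\<close> requires.\<close>

lemma bij_betw_zeta_sum_vertices:
  assumes "prime p"
  shows "bij_betw (zeta_sum p) (PiE {1..p-1} (\<lambda>_. {-N, N})) (cyc_vertices p N)"
  unfolding bij_betw_def
proof (intro conjI inj_onI equalityI subsetI)
  show "a = b" if "a \<in> PiE {1..p-1} (\<lambda>_. {-N, N})" "b \<in> PiE {1..p-1} (\<lambda>_. {-N, N})"
    "zeta_sum p a = zeta_sum p b" for a b
    using that(1,2) zeta_sum_inject [OF assms that(3)] by (rule PiE_ext)
next
  fix z assume "z \<in> zeta_sum p ` PiE {1..p-1} (\<lambda>_. {-N, N})"
  then obtain a where "z = zeta_sum p a" "a \<in> PiE {1..p-1} (\<lambda>_. {-N, N})" by blast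
  thus "z \<in> cyc_vertices p N"
    unfolding cyc_vertices_def zeta_sum_def by blast
next
  fix z assume "z \<in> cyc_vertices p N"
  then obtain a where a: "z = zeta_sum p a" "\<forall>j\<in>{1..p-1}. a j \<in> {-N, N}"
    unfolding cyc_vertices_def zeta_sum_def by blast
  have "z = zeta_sum p (restrict a {1..p-1})"
    unfolding a(1) zeta_sum_def by (intro sum.cong) auto
  moreover have "restrict a {1..p-1} \<in> PiE {1..p-1} (\<lambda>_. {-N, N})" using a(2) by auto
  ultimately show "z \<in> zeta_sum p ` PiE {1..p-1} (\<lambda>_. {-N, N})" by blast
qed

text \<open>A union bound: a large cosine forces either a large coordinate sum of \<beta>, which may
  shrink its norm, or a large value of the form. Markov's inequality for the two squares bounds each
  event and gives one summand each.\<close>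

lemma card_cos_angle_gt_le:
  fixes N :: int and t :: real
  assumes p: "prime p" and N: "N > 0" and t: "t > 0" and a: "trace_form p a a > 0"
  defines "\<Omega> \<equiv> PiE {1..p-1} (\<lambda>_. {-N, N})"
  shows "real (card {b \<in> \<Omega>. \<bar>cyc_cos_angle p N (zeta_sum p a) 0 (zeta_sum p b)\<bar> > t})
    \<le> real (card \<Omega>) * (2 * (real p + 1) / (real p)\<^sup>2 + 2 / (t\<^sup>2 * (real p - 1)))"
proof -
  define P where "P = real p"
  define M where "M = real_of_int N"
  define S where "S b = (\<Sum>j=1..p-1. real_of_int (b j))" for b :: "nat \<Rightarrow> int"
  have P: "P > 1" using prime_gt_1_nat [OF p] by (simp add: P_def)
  have n: "real (p - Suc 0) = P - 1" using prime_gt_1_nat [OF p] by (simp add: P_def)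
  have M: "M > 0" using N by (simp add: M_def)
  have fin: "finite \<Omega>" unfolding \<Omega>_def by (intro finite_PiE) auto
  have card: "real (card \<Omega>) = 2 ^ (p - 1)" using N by (simp add: \<Omega>_def card_PiE)
  \<comment> \<open>\<open>c\<close> collects the coefficients of the linear functional
    \<open>trace_form p a\<close>. The threshold \<open>T\<close> makes (P + 1) T half the main term
    of the squared norm of \<beta>; \<open>U\<close> is t^2 A times the lower bound left for that
    squared norm.\<close>
  define A where "A = trace_form p a a"
  have A: "A > 0" using a by (simp add: A_def)
  define c where "c j = P\<^sup>2 * real_of_int (a j) - (P + 1) * S a" for j
  define T where "T = P\<^sup>2 * M\<^sup>2 * (P - 1) / (2 * (P + 1))"
  define U where "U = t\<^sup>2 * A * (P\<^sup>2 * M\<^sup>2 * (P - 1) / 2)"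
  have T: "T > 0" and U: "U > 0" using P M A t by (auto simp: T_def U_def)
  have form: "trace_form p a b = (\<Sum>j=1..p-1. c j * real_of_int (b j))" for b
    using prime_gt_0_nat [OF p]
    by (simp add: trace_form_eq c_def P_def S_def left_diff_distrib sum_subtractf mult.assoc flip: sum_distrib_left)
  have "(\<Sum>b\<in>\<Omega>. (S b)\<^sup>2) = real (card \<Omega>) * (M\<^sup>2 * (P - 1))"
    using sum_PiE_signs_power2 [of "{1..p-1}" N "\<lambda>_. 1"] N n card
    by (simp add: \<Omega>_def S_def M_def)
  with Markov_card [OF fin, of "\<lambda>b. (S b)\<^sup>2" T]
  have "real (card {b \<in> \<Omega>. (S b)\<^sup>2 > T}) * T \<le> real (card \<Omega>) * (M\<^sup>2 * (P - 1))" by simp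
  hence "real (card {b \<in> \<Omega>. (S b)\<^sup>2 > T}) \<le> real (card \<Omega>) * (M\<^sup>2 * (P - 1)) / T"
    using T by (simp add: pos_le_divide_eq)
  also have "\<dots> = real (card \<Omega>) * (2 * (P + 1) / P\<^sup>2)"
    using P M by (simp add: T_def field_simps)
  finally have 1: "real (card {b \<in> \<Omega>. (S b)\<^sup>2 > T}) \<le> real (card \<Omega>) * (2 * (P + 1) / P\<^sup>2)" .
  \<comment> \<open>The sum equals P^2 A - (P + 1) (S a)^2, and the correction has the favourable
    sign.\<close>
  have c: "(\<Sum>j=1..p-1. (c j)\<^sup>2) \<le> P\<^sup>2 * A"
  proof -
    have "(\<Sum>j=1..p-1. (c j)\<^sup>2) = (\<Sum>j=1..p-1. P^4 * (real_of_int (a j))\<^sup>2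
        - 2 * P\<^sup>2 * (P + 1) * S a * real_of_int (a j) + (P + 1)\<^sup>2 * (S a)\<^sup>2)"
      by (intro sum.cong) (simp_all add: c_def power2_eq_square power4_eq_xxxx algebra_simps)
    also have "\<dots> = P^4 * (\<Sum>j=1..p-1. (real_of_int (a j))\<^sup>2)
        - 2 * P\<^sup>2 * (P + 1) * S a * S a + (P - 1) * ((P + 1)\<^sup>2 * (S a)\<^sup>2)"
      by (simp add: sum.distrib sum_subtractf S_def n flip: sum_distrib_left)
    also have "\<dots> = P\<^sup>2 * A - (P + 1) * (S a)\<^sup>2"
      using prime_gt_0_nat [OF p]
      by (simp add: A_def trace_form_eq S_def P_def power2_eq_square power4_eq_xxxx algebra_simps)
    finally show ?thesis using P by simp
  qed
  have "(\<Sum>b\<in>\<Omega>. (trace_form p a b)\<^sup>2) = real (card \<Omega>) * M\<^sup>2 * (\<Sum>j=1..p-1. (c j)\<^sup>2)"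
    using sum_PiE_signs_power2 [of "{1..p-1}" N c] N card by (simp add: \<Omega>_def form M_def)
  also have "\<dots> \<le> real (card \<Omega>) * M\<^sup>2 * (P\<^sup>2 * A)"
    by (intro mult_left_mono c) simp
  finally have "real (card {b \<in> \<Omega>. (trace_form p a b)\<^sup>2 > U}) * U \<le> real (card \<Omega>) * M\<^sup>2 * (P\<^sup>2 * A)"
    using Markov_card [OF fin, of "\<lambda>b. (trace_form p a b)\<^sup>2" U] by simp
  hence "real (card {b \<in> \<Omega>. (trace_form p a b)\<^sup>2 > U}) \<le> real (card \<Omega>) * M\<^sup>2 * (P\<^sup>2 * A) / U"
    using U by (simp add: pos_le_divide_eq)
  also have "\<dots> = real (card \<Omega>) * (2 / (t\<^sup>2 * (P - 1)))"
    using P M A t by (simp add: U_def field_simps)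
  finally have 2: "real (card {b \<in> \<Omega>. (trace_form p a b)\<^sup>2 > U}) \<le> real (card \<Omega>) * (2 / (t\<^sup>2 * (P - 1)))" .
  \<comment> \<open>Outside both exceptional sets the squared norm \<open>B\<close> keeps half of
    its main term, so the bound \<open>U\<close> becomes t^2 A B.\<close>
  have small: "\<bar>cyc_cos_angle p N (zeta_sum p a) 0 (zeta_sum p b)\<bar> \<le> t"
    if b: "b \<in> \<Omega>" "(S b)\<^sup>2 \<le> T" "(trace_form p a b)\<^sup>2 \<le> U" for b
  proof -
    define B where "B = trace_form p b b"
    have "real_of_int (b j) * real_of_int (b j) = M\<^sup>2" if "j \<in> {1..p-1}" for j
    proof -
      have "b j = - N \<or> b j = N" using b(1) that by (auto simp: \<Omega>_def)
      thus ?thesis by (auto simp: M_def power2_eq_square)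
    qed
    hence "(\<Sum>j=1..p-1. real_of_int (b j) * real_of_int (b j)) = (P - 1) * M\<^sup>2"
      by (simp add: n)
    hence "B = P\<^sup>2 * M\<^sup>2 * (P - 1) - (P + 1) * (S b)\<^sup>2"
      using prime_gt_0_nat [OF p]
      by (simp add: B_def trace_form_eq S_def P_def power2_eq_square mult_ac)
    moreover have "(P + 1) * (S b)\<^sup>2 \<le> (P + 1) * T" using b(2) P by (intro mult_left_mono) auto
    moreover have "(P + 1) * T = P\<^sup>2 * M\<^sup>2 * (P - 1) / 2" using P by (simp add: T_def field_simps)
    ultimately have B: "B \<ge> P\<^sup>2 * M\<^sup>2 * (P - 1) / 2" by linarith
    moreover have "P\<^sup>2 * M\<^sup>2 * (P - 1) / 2 > 0" using P M by simp
    ultimately have "B > 0" by linarith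
    have "(trace_form p a b)\<^sup>2 \<le> t\<^sup>2 * A * B"
      using mult_left_mono [OF B, of "t\<^sup>2 * A"] b(3) A by (simp add: U_def)
    hence "\<bar>trace_form p a b\<bar> \<le> sqrt (t\<^sup>2 * A * B)"
      by (intro real_le_rsqrt) simp
    also have "\<dots> = t * (sqrt A * sqrt B)" using t by (simp add: real_sqrt_mult)
    finally show ?thesis
      using \<open>B > 0\<close> A
      by (simp add: cyc_cos_angle_zeta_sum [OF p N] abs_mult pos_divide_le_eq flip: A_def B_def)
  qed
  have "{b \<in> \<Omega>. \<bar>cyc_cos_angle p N (zeta_sum p a) 0 (zeta_sum p b)\<bar> > t}
      \<subseteq> {b \<in> \<Omega>. (S b)\<^sup>2 > T} \<union> {b \<in> \<Omega>. (trace_form p a b)\<^sup>2 > U}"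
    using small by force
  hence "card {b \<in> \<Omega>. \<bar>cyc_cos_angle p N (zeta_sum p a) 0 (zeta_sum p b)\<bar> > t}
      \<le> card {b \<in> \<Omega>. (S b)\<^sup>2 > T} + card {b \<in> \<Omega>. (trace_form p a b)\<^sup>2 > U}"
    using fin by (intro order_trans [OF card_mono card_Un_le]) auto
  with 1 2 show ?thesis by (simp add: P_def distrib_left)
qed

theorem theorem7:
  shows "\<exists>C\<^sub>3>0. \<exists>C\<^sub>4>0. \<forall>(\<eta>::real) (p::nat) (\<gamma>::real) (N::int) (\<alpha>::complex).
    0 < \<eta> \<and> \<eta> < 1/2 \<and>
    Factorial_Ring.prime p \<and> odd p \<and> real p \<ge> 2 powr (1 / \<eta>) \<and>
    0 < \<gamma> \<and> \<gamma> \<le> \<eta> - ln 2 / ln (real p) \<and>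
    N \<ge> 1 \<and> \<alpha> \<in> cyc_box p N \<and>
    cyc_dist p N 0 \<alpha> \<ge> real p powr (\<gamma> - \<eta>) \<longrightarrow>
    real (card {\<beta> \<in> cyc_vertices p N. \<bar>cyc_cos_angle p N \<alpha> 0 \<beta>\<bar> \<le> C\<^sub>3 * real p powr (- \<gamma>)})
        / real (card (cyc_vertices p N))
      \<ge> 1 - C\<^sub>4 / real p powr (1 - 2 * \<eta>)"
proof (rule exI [of _ 1], intro conjI, simp, rule exI [of _ 8], intro conjI allI impI, simp, elim conjE)
  \<comment> \<open>The witnesses are C_3 = 1 and C_4 = 8; the two terms of the exceptional
    proportion contribute 4 each to C_4.\<close>
  fix \<eta> \<gamma> :: real and p :: nat and N :: int and \<alpha> :: complex
  assume \<eta>: "0 < \<eta>" "\<eta> < 1/2" and p: "Factorial_Ring.prime p"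
    and \<gamma>: "0 < \<gamma>" "\<gamma> \<le> \<eta> - ln 2 / ln (real p)"
    and N: "N \<ge> 1" and \<alpha>: "\<alpha> \<in> cyc_box p N" "cyc_dist p N 0 \<alpha> \<ge> real p powr (\<gamma> - \<eta>)"
  define \<Omega> where "\<Omega> = PiE {1..p-1} (\<lambda>_. {-N, N})"
  define t where "t = real p powr (- \<gamma>)"
  let ?good = "{\<beta> \<in> cyc_vertices p N. \<bar>cyc_cos_angle p N \<alpha> 0 \<beta>\<bar> \<le> 1 * real p powr (- \<gamma>)}"
  let ?q = "real p powr (2 * \<eta> - 1)"
  have p1: "real p > 1" using prime_gt_1_nat [OF p] by simp
  have p2: "real p \<ge> 2" using prime_ge_2_nat [OF p] by simp
  have t: "t > 0" using p1 by (simp add: t_def)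
  have "ln 2 / ln (real p) \<ge> 0" using p1 by simp
  hence \<gamma>\<eta>: "\<gamma> \<le> \<eta>" using \<gamma>(2) by linarith
  obtain a where a: "\<alpha> = zeta_sum p a"
    using \<alpha>(1) unfolding cyc_box_def zeta_sum_def by blast
  \<comment> \<open>A nonzero distance from 0 makes the form of \<open>a\<close> positive, as the
    bound on the exceptional set demands.\<close>
  have "real p powr (\<gamma> - \<eta>) > 0" using p1 by simp
  hence "cyc_dist p N 0 \<alpha> \<noteq> 0" using \<alpha>(2) by linarith
  hence A: "trace_form p a a > 0"
    using trace_form_nonneg [of p a] by (auto simp: cyc_dist_def a trace_norm_zeta_sum [OF p])
  note bij = bij_betw_zeta_sum_vertices [OF p, of N, folded \<Omega>_def]
  have fin: "finite \<Omega>" unfolding \<Omega>_def by (intro finite_PiE) auto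
  have card\<Omega>: "card \<Omega> > 0" using N by (simp add: \<Omega>_def card_PiE)
  have card_V: "card (cyc_vertices p N) = card \<Omega>" using bij_betw_same_card [OF bij] by simp
  have "bij_betw (zeta_sum p) {b \<in> \<Omega>. \<bar>cyc_cos_angle p N \<alpha> 0 (zeta_sum p b)\<bar> \<le> t} ?good"
    using bij by (auto simp: bij_betw_def t_def inj_on_def)
  hence "card ?good = card {b \<in> \<Omega>. \<bar>cyc_cos_angle p N \<alpha> 0 (zeta_sum p b)\<bar> \<le> t}"
    by (rule bij_betw_same_card [symmetric])
  also have "\<dots> = card \<Omega> - card {b \<in> \<Omega>. \<bar>cyc_cos_angle p N \<alpha> 0 (zeta_sum p b)\<bar> > t}"
    using fin by (subst card_Diff_subset [symmetric]) (auto intro!: arg_cong [where f = card])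
  \<comment> \<open>The subtraction of cardinalities is on natural numbers; passing to the reals as
    an inequality is safe even under truncation.\<close>
  also have "real \<dots> \<ge> real (card \<Omega>) - real (card {b \<in> \<Omega>. \<bar>cyc_cos_angle p N \<alpha> 0 (zeta_sum p b)\<bar> > t})"
    by linarith
  finally have "real (card ?good) \<ge> real (card \<Omega>) - real (card {b \<in> \<Omega>. \<bar>cyc_cos_angle p N \<alpha> 0 (zeta_sum p b)\<bar> > t})" .
  moreover have "real (card {b \<in> \<Omega>. \<bar>cyc_cos_angle p N \<alpha> 0 (zeta_sum p b)\<bar> > t})
      \<le> real (card \<Omega>) * (2 * (real p + 1) / (real p)\<^sup>2 + 2 / (t\<^sup>2 * (real p - 1)))"
    unfolding \<Omega>_def a using N by (intro card_cos_angle_gt_le p t A) simp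
  moreover have "2 * (real p + 1) / (real p)\<^sup>2 + 2 / (t\<^sup>2 * (real p - 1)) \<le> 8 * ?q"
  proof -
    have "2 * (real p + 1) / (real p)\<^sup>2 \<le> 4 * real p powr (- 1)"
      using p2 by (simp add: powr_minus field_simps power2_eq_square)
    also have "real p powr (- 1) \<le> ?q" using p1 \<eta> by (intro powr_mono) auto
    finally have 1: "2 * (real p + 1) / (real p)\<^sup>2 \<le> 4 * ?q" by simp
    have "t\<^sup>2 = real p powr (- 2 * \<gamma>)" by (simp add: t_def power2_eq_square flip: powr_add)
    hence "2 / (t\<^sup>2 * (real p - 1)) = 2 * real p powr (2 * \<gamma>) / (real p - 1)"
      by (simp add: powr_minus field_simps)
    \<comment> \<open>For p at least 2, p - 1 is at least p / 2.\<close>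
    also have "\<dots> \<le> 2 * real p powr (2 * \<gamma>) / (real p / 2)"
      using p2 by (intro divide_left_mono) auto
    also have "\<dots> = 4 * real p powr (2 * \<gamma> - 1)" using p1 by (simp add: powr_diff)
    also have "real p powr (2 * \<gamma> - 1) \<le> ?q" using p1 \<gamma>\<eta> by (intro powr_mono) auto
    finally have "2 / (t\<^sup>2 * (real p - 1)) \<le> 4 * ?q" by simp
    with 1 show ?thesis by simp
  qed
  ultimately have "real (card ?good) \<ge> real (card \<Omega>) * (1 - 8 * ?q)"
    using mult_left_mono [of "2 * (real p + 1) / (real p)\<^sup>2 + 2 / (t\<^sup>2 * (real p - 1))" "8 * ?q" "real (card \<Omega>)"]
    by (simp add: algebra_simps)
  hence "1 - 8 * ?q \<le> real (card ?good) / real (card (cyc_vertices p N))"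
    using card\<Omega> unfolding card_V by (simp add: pos_le_divide_eq mult.commute)
  moreover have "8 / real p powr (1 - 2 * \<eta>) = 8 * ?q"
    using powr_minus_divide [of "real p" "1 - 2 * \<eta>"] by simp
  ultimately show "1 - 8 / real p powr (1 - 2 * \<eta>) \<le> real (card ?good) / real (card (cyc_vertices p N))"
    by simp
qed

end
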